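(* Let $N\geq1$, let $\boldsymbol{\eta},\boldsymbol{\theta}\in\mathbb{R}^N$, $\boldsymbol{\theta}=(\theta_1,\dots,\theta_N)$, and let $A\subseteq[-\tfrac12,\tfrac12]^N$ be a compact set. Let $(\boldsymbol{v}_k)_{k=1}^N$ be a basis of $\mathbb{R}^N$ such that there exist real numbers $t_1,\dots,t_N$ satisfying $\boldsymbol{v}_k\in t_k\boldsymbol{\theta}+\mathbb{Z}^N$ for $k=1,\dots,N$. Let $d_1,\dots,d_N$ be positive numbers such that \[ \pm\boldsymbol{v}_1\pm\dots\pm\boldsymbol{v}_N\in D:=\prod_{n=1}^N[-d_n,d_n] \] for each possible combination of $\pm$ signs. Let \[ A'=\left\{\boldsymbol{v}\in A:\ \boldsymbol{v}+\tfrac32 D\subseteq A\right\}. \] Then for every $\delta>0$ there exists an increasing sequence of non-negative numbers $(\tau_\ell)_{\ell=1}^\infty$ such that for all $\ell$ we have $\tau_\ell\boldsymbol{\theta}\in\boldsymbol{\eta}+A+\mathbb{Z}^N$ and $\tau_{\ell+1}\geq\tau_\ell+\delta$, and \[ \liminf_{\ell\to\infty}\frac{\ell}{\tau_\ell}\geq\frac{1}{\delta}\operatorname{vol}(A'). \]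
   Context: $\operatorname{vol}$ denotes $N$-dimensional Lebesgue measure; $\tfrac32 D=\{\tfrac32\boldsymbol{x}:\boldsymbol{x}\in D\}$ and $\boldsymbol{v}+\tfrac32D$ is the translate.
   Formalization: The set A' is additionally assumed to be nonempty; without this the claim fails, e.g. for A empty, where no τ satisfies τθ ∈ η + A + Z^N. *)

theory Defs
  imports "HOL-Analysis.Analysis"
begin

definition int_lattice :: "(real ^ 'n) set" where
  "int_lattice = {z. \<forall>i. z $ i \<in> \<int>}"

end

theory Submission
  imports Defs
begin

text \<open>
  Let \<open>T\<close> be the closed set of times \<open>\<tau>\<close> with \<open>\<tau>\<theta> \<in> \<eta> + A + \<int>\<^sup>N\<close>, and choose \<open>\<tau>\<^sub>l\<^sub>+\<^sub>1\<close>
  greedily as the least element of \<open>T\<close> beyond \<open>\<tau>\<^sub>l + \<delta>\<close>.  The intervals \<open>[\<tau>\<^sub>l, \<tau>\<^sub>l + \<delta>)\<close> cover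
  the non-negative part of \<open>T\<close>, so \<open>l/\<tau>\<^sub>l\<close> is asymptotically at least \<open>1/\<delta>\<close> times the lower density of \<open>T\<close>.

  To bound that density, let \<open>B = {b. b + D \<subseteq> A}\<close>.  If \<open>\<tau>\<theta> - \<eta> + \<Sum>c\<^sub>kv\<^sub>k\<close> lies in \<open>B + \<int>\<^sup>N\<close> for
  real \<open>c\<^sub>k\<close>, then rounding every \<open>c\<^sub>k\<close> down moves the point by an element of \<open>D\<close>, hence into
  \<open>A + \<int>\<^sup>N\<close>; as \<open>v\<^sub>k \<equiv> t\<^sub>k\<theta>\<close> modulo \<open>\<int>\<^sup>N\<close>, this says that \<open>\<tau> + \<Sum>\<lfloor>c\<^sub>k\<rfloor>t\<^sub>k\<close> belongs to \<open>T\<close>.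
  For every \<open>\<tau>\<close> the proportion of such \<open>c\<close> in a large cube is almost \<open>vol B\<close>, because \<open>B + \<int>\<^sup>N\<close> is
  periodic.  Exchanging the averages over \<open>c\<close> and over \<open>\<tau> \<in> [0, R]\<close> shows that \<open>T\<close> has
  lower density at least \<open>vol B\<close>.
\<close>

section \<open>Translation invariance and double counting for Lebesgue measure\<close>

lemma emeasure_lborel_vimage_plus:
  fixes a :: "'a::euclidean_space"
  assumes "S \<in> sets borel"
  shows "emeasure lborel {x. a + x \<in> S} = emeasure lborel S"
proof -
  have "emeasure lborel S = emeasure (distr lborel borel ((+) a)) S"
    by (simp add: lborel_distr_plus)
  also have "\<dots> = emeasure lborel {x. a + x \<in> S}"
    using assms by (subst emeasure_distr) (auto simp: vimage_def)
  finally show ?thesis by simp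
qed

text \<open>Tonelli for the part of \<open>E\<close> inside \<open>X \<times> Y\<close>: its measure
  is bounded below through the sections at fixed \<open>x\<close> and above through those at fixed
  \<open>y\<close>.\<close>

lemma lborel_double_counting:
  fixes E :: "('a::euclidean_space \<times> 'b::euclidean_space) set"
  assumes X: "X \<in> sets borel" and Y: "Y \<in> sets borel" and E: "E \<in> sets borel"
    and ge: "\<And>x. x \<in> X \<Longrightarrow> a \<le> emeasure lborel {y\<in>Y. (x, y) \<in> E}"
    and le: "\<And>y. y \<in> Y \<Longrightarrow> emeasure lborel {x\<in>X. (x, y) \<in> E} \<le> b"
  shows "a * emeasure lborel X \<le> b * emeasure lborel Y"
proof -
  define E' where "E' = E \<inter> X \<times> Y"
  have E'0: "E' \<in> sets borel"
    unfolding E'_def using E X Y borel_Times by blast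
  have E': "E' \<in> sets (lborel \<Otimes>\<^sub>M lborel)"
    unfolding lborel_prod using E'0 by simp
  have 1: "a * emeasure lborel X \<le> (\<integral>\<^sup>+x. emeasure lborel (Pair x -` E') \<partial>lborel)"
  proof -
    have "a * emeasure lborel X = (\<integral>\<^sup>+x. a * indicator X x \<partial>lborel)"
      using X by (simp add: nn_integral_cmult_indicator)
    also have "\<dots> \<le> (\<integral>\<^sup>+x. emeasure lborel (Pair x -` E') \<partial>lborel)"
    proof (intro nn_integral_mono)
      fix x
      have "Pair x -` E' = {y\<in>Y. (x, y) \<in> E}" if "x \<in> X"
        using that by (auto simp: E'_def)
      then show "a * indicator X x \<le> emeasure lborel (Pair x -` E')"
        using ge[of x] by (auto simp: indicator_def)
    qed
    finally show ?thesis .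
  qed
  have 2: "(\<integral>\<^sup>+y. emeasure lborel ((\<lambda>x. (x, y)) -` E') \<partial>lborel) \<le> b * emeasure lborel Y"
  proof -
    have "(\<integral>\<^sup>+y. emeasure lborel ((\<lambda>x. (x, y)) -` E') \<partial>lborel) \<le> (\<integral>\<^sup>+y. b * indicator Y y \<partial>lborel)"
    proof (intro nn_integral_mono)
      fix y
      have "(\<lambda>x. (x, y)) -` E' = (if y \<in> Y then {x\<in>X. (x, y) \<in> E} else {})"
        by (auto simp: E'_def)
      then show "emeasure lborel ((\<lambda>x. (x, y)) -` E') \<le> b * indicator Y y"
        using le[of y] by (auto simp: indicator_def)
    qed
    also have "\<dots> = b * emeasure lborel Y"
      using Y by (simp add: nn_integral_cmult_indicator)
    finally show ?thesis .
  qed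
  show ?thesis
    using 1 2 lborel.emeasure_pair_measure_alt[OF E'] lborel_pair.emeasure_pair_measure_alt2[OF E']
    by simp
qed

subsection \<open>Periodization modulo the integer lattice\<close>

lemma zero_in_int_lattice [simp]: "0 \<in> int_lattice"
  by (simp add: int_lattice_def)

lemma int_lattice_diff: "x \<in> int_lattice \<Longrightarrow> y \<in> int_lattice \<Longrightarrow> x - y \<in> int_lattice"
  by (simp add: int_lattice_def)

lemma int_lattice_scaleR_of_int: "x \<in> int_lattice \<Longrightarrow> of_int n *\<^sub>R x \<in> int_lattice"
  by (simp add: int_lattice_def)

lemma int_lattice_sum: "(\<And>k. k \<in> K \<Longrightarrow> f k \<in> int_lattice) \<Longrightarrow> sum f K \<in> int_lattice"
  by (auto simp: int_lattice_def intro: Ints_sum)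

lemma countable_int_lattice: "countable (int_lattice :: (real ^ 'n) set)"
  unfolding int_lattice_def by (intro countable_vector countable_int)

lemma closed_int_lattice: "closed (int_lattice :: (real ^ 'n) set)"
proof -
  have "int_lattice = (\<Inter>i. (\<lambda>z::real^'n. z $ i) -` \<int>)"
    by (auto simp: int_lattice_def)
  moreover have "closed ((\<lambda>z::real^'n. z $ i) -` \<int>)" for i
    by (intro closed_vimage closed_Ints continuous_intros)
  ultimately show ?thesis by (metis (mono_tags, lifting) closed_INT)
qed

lemma int_lattice_eq_if_close:
  fixes z z' :: "real ^ 'n"
  assumes "z \<in> int_lattice" "z' \<in> int_lattice" and "\<And>i. \<bar>z $ i - z' $ i\<bar> < 1"
  shows "z = z'"
proof (rule vec_eq_iff[THEN iffD2], rule allI)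
  fix i
  have "z $ i - z' $ i \<in> \<int>" using assms by (simp add: int_lattice_def)
  then show "z $ i = z' $ i"
    using assms(3)[of i] Ints_nonzero_abs_less1 by fastforce
qed

text \<open>Half-open, so that it holds exactly one representative of each coset of
  \<open>int_lattice\<close>.\<close>

definition unit_cell :: "(real ^ 'n) set"
  where "unit_cell = {u. \<forall>i. 0 \<le> u $ i \<and> u $ i < 1}"

lemma unit_cell_borel [measurable]: "unit_cell \<in> sets (borel :: (real ^ 'n) measure)"
proof -
  have "unit_cell = (\<Inter>i. {u::real^'n. 0 \<le> u $ i} \<inter> {u. u $ i < 1})"
    by (auto simp: unit_cell_def)
  also have "\<dots> \<in> sets borel"
    by (intro sets.finite_INT sets.Int borel_closed borel_open closed_Collect_le open_Collect_less
          continuous_intros) auto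
  finally show ?thesis .
qed

lemma emeasure_unit_cell_le: "emeasure lborel (unit_cell :: (real ^ 'n) set) \<le> 1"
proof -
  have "unit_cell \<subseteq> cbox (0::real^'n) 1"
    by (auto simp: unit_cell_def mem_box_cart less_imp_le)
  then have "emeasure lborel (unit_cell :: (real ^ 'n) set) \<le> emeasure lborel (cbox (0::real^'n) 1)"
    by (intro emeasure_mono) auto
  also have "cbox (0::real^'n) 1 \<noteq> {}"
    by (simp add: interval_ne_empty_cart)
  then have "emeasure lborel (cbox (0::real^'n) 1) = ennreal 1"
    by (subst emeasure_eq_ennreal_measure) (auto simp: content_cbox_cart emeasure_lborel_cbox_eq)
  finally show ?thesis by simp
qed

text \<open>Cut and reassemble: lattice translates cut \<open>B\<close> into pieces
  \<open>G z\<close>, and the part of the shifted cell covered by the periodized \<open>B\<close>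
  into pieces \<open>F z\<close>. Corresponding pieces are translates of each other, so countable
  additivity makes the two measures equal.\<close>

lemma emeasure_periodization_ge:
  fixes B :: "(real ^ 'n) set"
  assumes B: "B \<in> sets borel"
    and disj: "\<And>b b'. b \<in> B \<Longrightarrow> b' \<in> B \<Longrightarrow> b - b' \<in> int_lattice \<Longrightarrow> b = b'"
    and P: "{b + z | b z. b \<in> B \<and> z \<in> int_lattice} \<in> sets borel"
  shows "emeasure lborel B
      \<le> emeasure lborel {u\<in>unit_cell. w + u \<in> {b + z | b z. b \<in> B \<and> z \<in> int_lattice}}"
proof -
  define F where "F z = {u\<in>unit_cell. (w - z) + u \<in> B}" for z
  define G where "G z = {b\<in>B. (z - w) + b \<in> unit_cell}" for z
  let ?L = "int_lattice :: (real^'n) set"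
  have tr: "{u. a + u \<in> S} \<in> sets borel" if "S \<in> sets borel" for a :: "real^'n" and S
    using measurable_sets_borel[OF _ that, of "\<lambda>u. a + u"] by (simp add: vimage_def)
  have Fs: "F z \<in> sets borel" and Gs: "G z \<in> sets borel" for z
    unfolding F_def G_def using tr B unit_cell_borel by (simp_all add: Collect_conj_eq Int_def[symmetric])
  have FG: "emeasure lborel (F z) = emeasure lborel (G z)" for z
  proof -
    have "F z = {u. (w - z) + u \<in> G z}"
      by (auto simp: F_def G_def algebra_simps)
    then show ?thesis using emeasure_lborel_vimage_plus[OF Gs] by metis
  qed
  \<comment> \<open>A common point of two pieces would give two points of \<open>B\<close> congruent
    modulo the lattice, which \<open>disj\<close> forbids.\<close>
  have dF: "disjoint_family_on F ?L"
  proof (unfold disjoint_family_on_def, intro ballI impI equals0I)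
    fix z z' u assume *: "z \<in> ?L" "z' \<in> ?L" "z \<noteq> z'" "u \<in> F z \<inter> F z'"
    then have "(w - z + u) - (w - z' + u) \<in> int_lattice"
      using int_lattice_diff[of z' z] by (simp add: algebra_simps)
    with * disj[of "w - z + u" "w - z' + u"] show False by (auto simp: F_def)
  qed
  have dG: "disjoint_family_on G ?L"
  proof (unfold disjoint_family_on_def, intro ballI impI equals0I)
    fix z z' b assume *: "z \<in> ?L" "z' \<in> ?L" "z \<noteq> z'" "b \<in> G z \<inter> G z'"
    have "\<bar>z $ i - z' $ i\<bar> < 1" for i
      using *(4) by (auto simp: G_def unit_cell_def dest!: spec[of _ i])
    with * int_lattice_eq_if_close show False by blast
  qed
  have UG: "(\<Union>z\<in>?L. G z) = B"
  proof
    show "B \<subseteq> (\<Union>z\<in>?L. G z)"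
    proof
      fix b assume "b \<in> B"
      \<comment> \<open>With this \<open>z\<close>, the vector \<open>z - w + b\<close> consists of
        the fractional parts of the coordinates of \<open>b - w\<close>.\<close>
      define z :: "real^'n" where "z = (\<chi> i. - of_int \<lfloor>b $ i - w $ i\<rfloor>)"
      have "z \<in> ?L" by (simp add: z_def int_lattice_def)
      moreover have "z - w + b \<in> unit_cell"
        unfolding unit_cell_def z_def
        by (simp, intro allI conjI; linarith)
      ultimately show "b \<in> (\<Union>z\<in>?L. G z)" using \<open>b \<in> B\<close> by (auto simp: G_def)
    qed
  qed (auto simp: G_def)
  have UF: "(\<Union>z\<in>?L. F z) = {u\<in>unit_cell. w + u \<in> {b + z | b z. b \<in> B \<and> z \<in> int_lattice}}"
  proof safe
    fix u b z assume *: "u \<in> unit_cell" "w + u = b + z" "b \<in> B" "z \<in> ?L"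
    then have "w - z + u = b" by (simp add: algebra_simps)
    with * show "u \<in> (\<Union>z\<in>?L. F z)" by (auto simp: F_def)
  next
    fix u z assume "z \<in> ?L" "u \<in> F z"
    then show "\<exists>b z. w + u = b + z \<and> b \<in> B \<and> z \<in> ?L"
      by (intro exI[of _ "w - z + u"] exI[of _ z]) (auto simp: F_def)
  qed (auto simp: F_def)
  have "emeasure lborel B = (\<integral>\<^sup>+z. emeasure lborel (G z) \<partial>count_space ?L)"
    unfolding UG[symmetric]
    by (rule emeasure_UN_countable) (use Gs dG countable_int_lattice in auto)
  also have "\<dots> = emeasure lborel (\<Union>z\<in>?L. F z)"
    unfolding FG[symmetric]
    by (rule emeasure_UN_countable[symmetric]) (use Fs dF countable_int_lattice in auto)
  finally show ?thesis unfolding UF by simp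
qed

lemma closed_add_int_lattice:
  fixes A :: "(real ^ 'n) set"
  assumes "compact A"
  shows "closed {a + z | a z. a \<in> A \<and> z \<in> int_lattice}"
proof -
  have "{a + z | a z. a \<in> A \<and> z \<in> int_lattice} = (\<Union>x\<in>A. \<Union>y\<in>int_lattice. {x + y})"
    by auto
  then show ?thesis using compact_closed_sums[OF assms closed_int_lattice] by simp
qed

definition cube :: "real \<Rightarrow> (real ^ 'n) set"
  where "cube r = cbox (\<chi> i. - r) (\<chi> i. r)"

lemma mem_cube: "x \<in> cube r \<longleftrightarrow> (\<forall>i. \<bar>x $ i\<bar> \<le> r)"
  by (auto simp: cube_def mem_box_cart abs_le_iff minus_le_iff)

lemma cube_borel [measurable]: "cube r \<in> sets borel"
  by (simp add: cube_def)

lemma emeasure_cube: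
  assumes "0 \<le> r"
  shows "emeasure lborel (cube r :: (real ^ 'n) set) = ennreal ((2 * r) ^ CARD('n))"
proof -
  have "cube r \<noteq> ({} :: (real ^ 'n) set)"
    using assms by (simp add: cube_def interval_ne_empty_cart)
  then show ?thesis
    unfolding cube_def
    by (subst emeasure_eq_ennreal_measure) (auto simp: content_cbox_cart emeasure_lborel_cbox_eq)
qed

text \<open>The order of quantifiers is the point: \<open>K\<close> depends on neither
  \<open>x\<close> nor \<open>M\<close>. Hence the bound can be used at every time with the same
  \<open>K\<close>, and enlarging the cube by \<open>K\<close> becomes negligible for large
  \<open>M\<close>.\<close>

lemma lattice_average_ge:
  fixes V :: "real ^ 'n \<Rightarrow> real ^ 'n" and B :: "(real ^ 'n) set"
  assumes V: "linear V" "surj V" and B: "compact B"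
    and disj: "\<And>b b'. b \<in> B \<Longrightarrow> b' \<in> B \<Longrightarrow> b - b' \<in> int_lattice \<Longrightarrow> b = b'"
  obtains K where "0 \<le> K" "\<And>M x. 0 \<le> M \<Longrightarrow>
      emeasure lborel B * emeasure lborel (cube M :: (real ^ 'n) set)
      \<le> emeasure lborel {c\<in>cube (M + K). x + V c \<in> {b + z | b z. b \<in> B \<and> z \<in> int_lattice}}"
proof -
  let ?P = "{b + z | b z. b \<in> B \<and> z \<in> int_lattice}"
  have P: "closed ?P" using B by (rule closed_add_int_lattice)
  have Pb: "?P \<in> sets borel" using P by (rule borel_closed)
  obtain G where G: "linear G" "V \<circ> G = id"
    using linear_surjective_right_inverse[OF V] by blast
  obtain L where L: "0 < L" "\<And>u. norm (G u) \<le> L * norm u"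
    using linear_bounded_pos[OF G(1)] by blast
  \<comment> \<open>A point of the unit cell has norm at most the dimension, by comparison with the
    l1 norm, so \<open>K\<close> bounds every coordinate of its preimage under
    \<open>V\<close>.\<close>
  define K where "K = L * real CARD('n)"
  have contV: "continuous_on UNIV V"
    using V(1) linear_continuous_on linear_conv_bounded_linear by blast
  have GK: "\<bar>G u $ i\<bar> \<le> K" if "u \<in> unit_cell" for u i
  proof -
    have "norm u \<le> (\<Sum>i\<in>UNIV. \<bar>u $ i\<bar>)" by (rule norm_le_l1_cart)
    also have "\<dots> \<le> (\<Sum>i\<in>(UNIV::'n set). 1)"
      using that by (intro sum_mono) (auto simp: unit_cell_def less_imp_le)
    finally have "norm u \<le> real CARD('n)" by simp
    then have "L * norm u \<le> K" using L(1) by (simp add: K_def)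
    then show ?thesis using L(2)[of u] component_le_norm_cart[of "G u" i] by linarith
  qed
  show thesis
  proof (rule that[of K])
    show "0 \<le> K" using L(1) by (simp add: K_def)
    fix M :: real and x assume M: "0 \<le> M"
    let ?b = "emeasure lborel {c\<in>cube (M + K). x + V c \<in> ?P}"
    define E where "E = {p. x + V (fst p) + snd p \<in> ?P}"
    have bset: "{c\<in>cube (M + K). x + V c \<in> ?P} \<in> sets borel"
    proof -
      have "closed ((\<lambda>c. x + V c) -` ?P)"
        by (intro closed_vimage[OF P] continuous_on_add contV continuous_on_const)
      then have "cube (M + K) \<inter> ((\<lambda>c. x + V c) -` ?P) \<in> sets borel" by auto
      then show ?thesis by (simp add: Int_def vimage_def)
    qed
    have "closed ((\<lambda>p. x + V (fst p) + snd p) -` ?P)"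
      by (intro closed_vimage[OF P] continuous_intros continuous_on_compose2[OF contV]) auto
    then have E: "E \<in> sets borel"
      unfolding E_def by (simp add: vimage_def)
    \<comment> \<open>Shifting \<open>x\<close> by \<open>u\<close> in the unit cell amounts to shifting \<open>c\<close> by the bounded vector \<open>G u\<close>, and
      averaging over all such \<open>u\<close> gives the volume of \<open>B\<close> exactly.\<close>
    have "emeasure lborel B * emeasure lborel (cube M :: (real^'n) set)
        \<le> ?b * emeasure lborel (unit_cell :: (real^'n) set)"
    proof (rule lborel_double_counting[where E = E])
      fix c :: "real^'n" assume "c \<in> cube M"
      show "emeasure lborel B \<le> emeasure lborel {u\<in>unit_cell. (c, u) \<in> E}"
        using emeasure_periodization_ge[of B "x + V c"] B Pb disj
        by (simp add: E_def borel_compact)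
    next
      fix u :: "real^'n" assume u: "u \<in> unit_cell"
      have VG: "V (G u) = u" using G(2) by (metis comp_apply id_apply)
      have "{c\<in>cube M. (c, u) \<in> E} \<subseteq> {c. G u + c \<in> {c\<in>cube (M + K). x + V c \<in> ?P}}"
      proof safe
        fix c assume c: "c \<in> cube M" "(c, u) \<in> E"
        show "G u + c \<in> cube (M + K)"
          unfolding mem_cube
        proof
          fix i show "\<bar>(G u + c) $ i\<bar> \<le> M + K"
            using c(1) GK[OF u, of i] abs_triangle_ineq[of "G u $ i" "c $ i"]
            by (auto simp: mem_cube dest!: spec[of _ i])
        qed
        have "x + V (G u + c) = x + V c + u"
          by (simp add: linear_add[OF V(1)] VG algebra_simps)
        then show "\<exists>b z. x + V (G u + c) = b + z \<and> b \<in> B \<and> z \<in> int_lattice"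
          using c(2) by (simp add: E_def add.assoc)
      qed
      then have "emeasure lborel {c\<in>cube M. (c, u) \<in> E}
          \<le> emeasure lborel {c. G u + c \<in> {c\<in>cube (M + K). x + V c \<in> ?P}}"
      proof (rule emeasure_mono)
        have "(+) (G u) \<in> borel_measurable borel" by measurable
        from measurable_sets_borel[OF this bset]
        show "{c. G u + c \<in> {c\<in>cube (M + K). x + V c \<in> ?P}} \<in> sets lborel"
          by (simp add: vimage_def)
      qed
      also have "\<dots> = ?b"
        by (rule emeasure_lborel_vimage_plus[OF bset])
      finally show "emeasure lborel {c\<in>cube M. (c, u) \<in> E} \<le> ?b" .
    qed (use E in auto)
    also have "\<dots> \<le> ?b * 1"
      by (intro mult_left_mono emeasure_unit_cell_le) auto
    finally show "emeasure lborel B * emeasure lborel (cube M :: (real^'n) set) \<le> ?b" by simp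
  qed
qed

subsection \<open>Density of visit times\<close>

text \<open>Closedness makes the set of visit times measurable and lets the greedy choice attain its
  infimum.\<close>

lemma closed_visit_times:
  fixes \<theta> \<eta> :: "real ^ 'n"
  assumes "compact A"
  shows "closed {\<tau>. \<tau> *\<^sub>R \<theta> - \<eta> \<in> {a + z | a z. a \<in> A \<and> z \<in> int_lattice}}"
proof -
  have "closed ((\<lambda>\<tau>. \<tau> *\<^sub>R \<theta> - \<eta>) -` {a + z | a z. a \<in> A \<and> z \<in> int_lattice})"
    by (intro closed_vimage closed_add_int_lattice[OF assms] continuous_intros)
  then show ?thesis by (simp add: vimage_def)
qed

text \<open>\<open>C\<close> may depend on \<open>M\<close> but not on \<open>R\<close>, and
  \<open>K\<close> on neither; so one can first let \<open>R\<close> grow to absorb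
  \<open>C\<close>, and then let \<open>M\<close> grow to absorb \<open>K\<close>.\<close>

lemma visit_times_count:
  fixes \<theta> \<eta> :: "real ^ 'n" and v :: "'n \<Rightarrow> real ^ 'n" and t :: "'n \<Rightarrow> real"
  assumes A: "compact A" and B: "compact B"
    and disj: "\<And>b b'. b \<in> B \<Longrightarrow> b' \<in> B \<Longrightarrow> b - b' \<in> int_lattice \<Longrightarrow> b = b'"
    and lat: "\<And>k. v k - t k *\<^sub>R \<theta> \<in> int_lattice"
    and surj: "surj (\<lambda>c :: real ^ 'n. \<Sum>k\<in>UNIV. c $ k *\<^sub>R v k)"
    and BA: "\<And>b s. b \<in> B \<Longrightarrow> (\<And>k. 0 \<le> s k \<and> s k \<le> 1) \<Longrightarrow> b - (\<Sum>k\<in>UNIV. s k *\<^sub>R v k) \<in> A"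
  defines "T \<equiv> {\<tau>. \<tau> *\<^sub>R \<theta> - \<eta> \<in> {a + z | a z. a \<in> A \<and> z \<in> int_lattice}}"
  obtains K where "0 \<le> K" "\<And>M. 0 \<le> M \<Longrightarrow> \<exists>C\<ge>0. \<forall>R\<ge>0.
      measure lborel B * (2 * M) ^ CARD('n) * R
      \<le> (measure lborel (T \<inter> {0..R}) + C) * (2 * (M + K)) ^ CARD('n)"
proof -
  define V where "V = (\<lambda>c :: real ^ 'n. \<Sum>k\<in>UNIV. c $ k *\<^sub>R v k)"
  let ?P = "{b + z | b z. b \<in> B \<and> z \<in> int_lattice}"
  let ?S = "{a + z | a z. a \<in> A \<and> z \<in> int_lattice}"
  define s where "s = (\<lambda>c :: real ^ 'n. \<Sum>k\<in>UNIV. of_int \<lfloor>c $ k\<rfloor> * t k)"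
  have linV: "linear V"
    by (rule linearI) (simp_all add: V_def scaleR_add_left sum.distrib scaleR_sum_right)
  obtain K where K: "0 \<le> K" and avg: "\<And>M x. 0 \<le> M \<Longrightarrow>
      emeasure lborel B * emeasure lborel (cube M :: (real ^ 'n) set)
      \<le> emeasure lborel {c\<in>cube (M + K). x + V c \<in> ?P}"
    using lattice_average_ge[OF linV _ B disj] surj unfolding V_def by blast
  have Tc: "closed T"
    unfolding T_def using A by (rule closed_visit_times)
  have sm: "s \<in> borel_measurable borel"
  proof -
    have "(\<lambda>c :: real^'n. of_int \<lfloor>c $ k\<rfloor> * t k) \<in> borel_measurable borel" for k
    proof -
      have "(\<lambda>c :: real^'n. c $ k) \<in> borel_measurable borel"
        by (intro borel_measurable_continuous_onI continuous_intros)
      then show ?thesis by measurable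
    qed
    then show ?thesis unfolding s_def by (intro borel_measurable_sum) auto
  qed
  have visit: "\<tau> + s c \<in> T" if "\<tau> *\<^sub>R \<theta> - \<eta> + V c \<in> ?P" for \<tau> c
  proof -
    obtain b z where b: "\<tau> *\<^sub>R \<theta> - \<eta> + V c = b + z" "b \<in> B" "z \<in> int_lattice"
      using \<open>\<tau> *\<^sub>R \<theta> - \<eta> + V c \<in> ?P\<close> by blast
    define a where "a = b - (\<Sum>k\<in>UNIV. frac (c $ k) *\<^sub>R v k)"
    \<comment> \<open>The lattice error of replacing each \<open>v k\<close> by
      \<open>t k *\<^sub>R \<theta>\<close> in the integer part of \<open>V c\<close>. Thus
      \<open>V c\<close> splits into a fractional part, the lattice vector \<open>w\<close> and the
      multiple \<open>s c\<close> of \<open>\<theta>\<close>.\<close>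
    define w where "w = (\<Sum>k\<in>UNIV. of_int \<lfloor>c $ k\<rfloor> *\<^sub>R (v k - t k *\<^sub>R \<theta>))"
    have "a \<in> A"
      unfolding a_def using b(2) by (intro BA) (auto simp: frac_ge_0 less_imp_le[OF frac_lt_1])
    moreover have "w \<in> int_lattice"
      unfolding w_def by (intro int_lattice_sum int_lattice_scaleR_of_int lat)
    moreover have "V c = (\<Sum>k\<in>UNIV. frac (c $ k) *\<^sub>R v k) + w + s c *\<^sub>R \<theta>"
      unfolding V_def w_def s_def frac_def
      by (simp add: scaleR_sum_left sum.distrib[symmetric] algebra_simps)
    then have "(\<tau> + s c) *\<^sub>R \<theta> - \<eta> = a + (z - w)"
      using b(1) by (simp add: a_def algebra_simps)
    ultimately show ?thesis
      unfolding T_def using b(3) int_lattice_diff by blast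
  qed
  show thesis
  proof (rule that[OF K])
    fix M :: real assume M: "0 \<le> M"
    \<comment> \<open>A bound for the time shift \<open>s c\<close>: rounding a coefficient of
      modulus at most \<open>M + K\<close> down gives modulus at most
      \<open>M + K + 1\<close>.\<close>
    define C where "C = (\<Sum>k\<in>UNIV. (M + K + 1) * \<bar>t k\<bar>)"
    have sC: "\<bar>s c\<bar> \<le> C" if "c \<in> cube (M + K)" for c
    proof -
      have "\<bar>real_of_int \<lfloor>c $ k\<rfloor>\<bar> \<le> M + K + 1" for k
      proof -
        have "\<bar>c $ k\<bar> \<le> M + K" using that by (simp add: mem_cube)
        then show ?thesis by linarith
      qed
      then have "\<bar>s c\<bar> \<le> (\<Sum>k\<in>UNIV. (M + K + 1) * \<bar>t k\<bar>)"
        unfolding s_def by (intro order_trans[OF sum_abs] sum_mono) (simp add: abs_mult mult_right_mono)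
      then show ?thesis by (simp add: C_def)
    qed
    have C: "0 \<le> C" unfolding C_def using M K by (intro sum_nonneg) auto
    show "\<exists>C\<ge>0. \<forall>R\<ge>0. measure lborel B * (2 * M) ^ CARD('n) * R
      \<le> (measure lborel (T \<inter> {0..R}) + C) * (2 * (M + K)) ^ CARD('n)"
    proof (intro exI[of _ "2 * C"] conjI allI impI)
      fix R :: real assume R: "0 \<le> R"
      let ?m = "measure lborel (T \<inter> {0..R})"
      have Bm: "emeasure lborel B = ennreal (measure lborel B)"
        using emeasure_compact_finite[OF B] by (subst emeasure_eq_ennreal_measure) auto
      have Tb: "T \<inter> {0..R} \<in> sets borel" using Tc by auto
      have Tm: "emeasure lborel (T \<inter> {0..R}) = ennreal ?m"
        using emeasure_compact_finite[of "T \<inter> {0..R}"] Tc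
        by (subst emeasure_eq_ennreal_measure) (auto simp: closed_Int_compact)
      define E where "E = {p. fst p + s (snd p) \<in> T}"
      have "(\<lambda>p. fst p + s (snd p)) \<in> borel_measurable borel"
      proof -
        have "(\<lambda>p :: real \<times> (real^'n). fst p + s (snd p)) \<in> borel_measurable (borel \<Otimes>\<^sub>M borel)"
          using sm by measurable
        then show ?thesis by (simp add: borel_prod)
      qed
      from measurable_sets_borel[OF this borel_closed[OF Tc]]
      have E: "E \<in> sets borel" by (simp add: E_def vimage_def)
      have "emeasure lborel B * emeasure lborel (cube M :: (real^'n) set) * emeasure lborel {0..R}
          \<le> ennreal (?m + 2 * C) * emeasure lborel (cube (M + K) :: (real^'n) set)"
      \<comment> \<open>The pairs counted are times in \<open>{0..R}\<close> and coefficient vectors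
        in \<open>cube (M + K)\<close>. At a fixed time, \<open>avg\<close> bounds the good vectors
        below; at a fixed vector, the good times form a subset of a translate of
        \<open>T\<close>.\<close>
      proof (rule lborel_double_counting[where E = E])
        fix \<tau> :: real
        have "{c\<in>cube (M + K). (\<tau> *\<^sub>R \<theta> - \<eta>) + V c \<in> ?P} \<subseteq> {c\<in>cube (M + K). (\<tau>, c) \<in> E}"
          using visit by (auto simp: E_def)
        moreover have "{c\<in>cube (M + K). (\<tau>, c) \<in> E} \<in> sets lborel"
        proof -
          have "{c\<in>cube (M + K). (\<tau>, c) \<in> E} = cube (M + K) \<inter> (\<lambda>c. \<tau> + s c) -` T"
            by (auto simp: E_def)
          moreover have "(\<lambda>c. \<tau> + s c) -` T \<in> sets borel"
          proof (rule measurable_sets_borel)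
            show "(\<lambda>c. \<tau> + s c) \<in> borel_measurable borel" using sm by measurable
          qed (rule borel_closed[OF Tc])
          ultimately show ?thesis by (simp add: sets.Int)
        qed
        ultimately show "emeasure lborel B * emeasure lborel (cube M :: (real^'n) set)
          \<le> emeasure lborel {c\<in>cube (M + K). (\<tau>, c) \<in> E}"
          by (rule order_trans[OF avg[OF M] emeasure_mono])
      next
        fix c :: "real^'n" assume c: "c \<in> cube (M + K)"
        \<comment> \<open>The shift by \<open>s c\<close> pushes \<open>{0..R}\<close> out by at
          most \<open>C\<close>; the two end intervals catch what leaves on either side and account
          for \<open>2 * C\<close>.\<close>
        let ?U = "T \<inter> {0..R} \<union> {- C..0} \<union> {R..R + C}"
        have "{\<tau>\<in>{0..R}. (\<tau>, c) \<in> E} \<subseteq> {\<tau>. s c + \<tau> \<in> ?U}"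
          using sC[OF c] by (auto simp: E_def add.commute)
        then have "emeasure lborel {\<tau>\<in>{0..R}. (\<tau>, c) \<in> E} \<le> emeasure lborel {\<tau>. s c + \<tau> \<in> ?U}"
        proof (rule emeasure_mono)
          have "(+) (s c) \<in> borel_measurable borel" by measurable
          moreover have "?U \<in> sets borel" using Tb by auto
          ultimately have "(+) (s c) -` ?U \<in> sets borel" by (rule measurable_sets_borel)
          then show "{\<tau>. s c + \<tau> \<in> ?U} \<in> sets lborel" by (simp add: vimage_def)
        qed
        also have "\<dots> = emeasure lborel ?U"
          by (rule emeasure_lborel_vimage_plus) (use Tb in auto)
        also have "\<dots> \<le> emeasure lborel (T \<inter> {0..R} \<union> {- C..0}) + emeasure lborel {R..R + C}"
          by (rule emeasure_subadditive) (use Tb in auto)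
        also have "\<dots> \<le> emeasure lborel (T \<inter> {0..R}) + emeasure lborel {- C..0} + emeasure lborel {R..R + C}"
          by (intro add_right_mono emeasure_subadditive) (use Tb in auto)
        also have "\<dots> = ennreal (?m + 2 * C)"
          using C by (simp add: Tm ennreal_plus[symmetric] del: ennreal_plus)
        finally show "emeasure lborel {\<tau>\<in>{0..R}. (\<tau>, c) \<in> E} \<le> ennreal (?m + 2 * C)" .
      qed (use E in auto)
      moreover have "emeasure lborel {0..R} = ennreal R" using R by simp
      ultimately have "ennreal (measure lborel B * (2 * M) ^ CARD('n) * R)
          \<le> ennreal ((?m + 2 * C) * (2 * (M + K)) ^ CARD('n))"
        using M K R C by (simp add: emeasure_cube Bm ennreal_mult)
      then show "measure lborel B * (2 * M) ^ CARD('n) * R \<le> (?m + 2 * C) * (2 * (M + K)) ^ CARD('n)"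
        using M K C by (subst (asm) ennreal_le_iff) auto
    qed (use C in simp)
  qed
qed

text \<open>Half of \<open>e\<close> pays for the ratio \<open>(M / (M + K)) ^ n\<close>, which
  tends to 1; with that \<open>M\<close> fixed, the other half absorbs \<open>C\<close> for large
  \<open>R\<close>.\<close>

lemma lower_density_of_box_counts:
  fixes m :: "real \<Rightarrow> real"
  assumes K: "0 \<le> K"
    and count: "\<And>M. 0 \<le> M \<Longrightarrow> \<exists>C\<ge>0. \<forall>R\<ge>0.
      \<beta> * (2 * M) ^ n * R \<le> (m R + C) * (2 * (M + K)) ^ n"
    and e: "0 < e"
  obtains R0 where "0 < R0" "\<And>R. R0 \<le> R \<Longrightarrow> (\<beta> - e) * R \<le> m R"
proof -
  have "((\<lambda>M. \<beta> * (M / (M + K)) ^ n) \<longlongrightarrow> \<beta> * 1 ^ n) at_top"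
  proof (intro tendsto_intros)
    have "((\<lambda>M. 1 - K / (M + K)) \<longlongrightarrow> 1 - 0) at_top"
      by (intro tendsto_intros tendsto_divide_0[OF tendsto_const] filterlim_at_top_imp_at_infinity
          filterlim_at_top_mono[OF filterlim_ident] always_eventually) (use K in auto)
    moreover have "\<forall>\<^sub>F M in at_top. 1 - K / (M + K) = M / (M + K)"
      using eventually_gt_at_top[of 0] by eventually_elim (use K in \<open>simp add: field_simps\<close>)
    ultimately show "((\<lambda>M. M / (M + K)) \<longlongrightarrow> 1) at_top"
      by (simp add: tendsto_cong)
  qed
  then have "\<forall>\<^sub>F M in at_top. \<beta> - e / 2 < \<beta> * (M / (M + K)) ^ n"
    by (rule order_tendstoD(1)) (use e in simp)
  then have "\<forall>\<^sub>F M in at_top. \<beta> - e / 2 < \<beta> * (M / (M + K)) ^ n \<and> 0 < M"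
    using eventually_gt_at_top[of 0] by (rule eventually_conj)
  then obtain M where M: "\<beta> - e / 2 < \<beta> * (M / (M + K)) ^ n" "0 < M"
    unfolding eventually_at_top_linorder by blast
  obtain C where C: "0 \<le> C" "\<And>R. 0 \<le> R \<Longrightarrow> \<beta> * (2 * M) ^ n * R \<le> (m R + C) * (2 * (M + K)) ^ n"
    using count[of M] M(2) by auto
  show thesis
  \<comment> \<open>Beyond this threshold \<open>C \<le> e / 2 * R\<close>; the extra 1 keeps the
    threshold positive when \<open>C\<close> is 0.\<close>
  proof (rule that[of "2 * (C + 1) / e"])
    show "0 < 2 * (C + 1) / e" using C e by simp
    fix R assume R: "2 * (C + 1) / e \<le> R"
    have R0: "0 \<le> R" using R C e by (smt (verit) divide_nonneg_pos)
    have "2 * (C + 1) \<le> R * e" using R e by (simp only: pos_divide_le_eq)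
    then have "C \<le> e / 2 * R" by (simp add: mult.commute)
    have "2 * M = M / (M + K) * (2 * (M + K))"
      using M(2) K by (simp add: field_simps)
    then have "(2 * M) ^ n = (M / (M + K) * (2 * (M + K))) ^ n"
      by (rule arg_cong)
    also have "\<dots> = (M / (M + K)) ^ n * (2 * (M + K)) ^ n"
      by (rule power_mult_distrib)
    finally have "\<beta> * (2 * M) ^ n * R = (\<beta> * (M / (M + K)) ^ n * R) * (2 * (M + K)) ^ n"
      by simp
    with C(2)[OF R0]
    have "(\<beta> * (M / (M + K)) ^ n * R) * (2 * (M + K)) ^ n \<le> (m R + C) * (2 * (M + K)) ^ n"
      by (simp only:)
    moreover have "0 < (2 * (M + K)) ^ n" using M(2) K by simp
    ultimately have "\<beta> * (M / (M + K)) ^ n * R \<le> m R + C"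
      by (rule mult_right_le_imp_le)
    moreover have "(\<beta> - e / 2) * R \<le> \<beta> * (M / (M + K)) ^ n * R"
      using M(1) R0 by (intro mult_right_mono) auto
    ultimately show "(\<beta> - e) * R \<le> m R"
      using \<open>C \<le> e / 2 * R\<close> by (simp add: algebra_simps)
  qed
qed

subsection \<open>Greedy separated sequences\<close>

text \<open>Minimality of each choice gives the covering: a point of \<open>T\<close> in
  \<open>{\<sigma> n + \<delta>..<\<sigma> (Suc n)}\<close> would have been chosen earlier.\<close>

lemma greedy_separated_sequence:
  fixes T :: "real set"
  assumes T: "closed T" and unb: "\<And>x. \<exists>t\<in>T. x \<le> t" and delta: "0 < \<delta>"
  obtains \<sigma> :: "nat \<Rightarrow> real" where "\<And>n. \<sigma> n \<in> T" "0 \<le> \<sigma> 0" "\<And>n. \<sigma> n + \<delta> \<le> \<sigma> (Suc n)"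
    "\<And>n. T \<inter> {0..<\<sigma> n} \<subseteq> (\<Union>i<n. {\<sigma> i..<\<sigma> i + \<delta>})"
proof -
  define nxt where "nxt x = Inf (T \<inter> {x..})" for x
  have ne: "T \<inter> {x..} \<noteq> {}" for x using unb[of x] by auto
  have bb: "bdd_below (T \<inter> {x..})" for x by (rule bdd_belowI[of _ x]) auto
  have nxt: "nxt x \<in> T \<inter> {x..}" for x
    unfolding nxt_def by (intro closed_contains_Inf ne bb closed_Int T closed_atLeast)
  have nxt_le: "nxt x \<le> y" if "y \<in> T" "x \<le> y" for x y
    unfolding nxt_def using that by (intro cInf_lower bb) auto
  define \<sigma> where "\<sigma> = rec_nat (nxt 0) (\<lambda>_ x. nxt (x + \<delta>))"
  have S0: "\<sigma> 0 = nxt 0" and SS: "\<And>n. \<sigma> (Suc n) = nxt (\<sigma> n + \<delta>)"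
    by (simp_all add: \<sigma>_def)
  show thesis
  proof (rule that[of \<sigma>])
    show "\<sigma> n \<in> T" for n using nxt by (cases n) (auto simp: S0 SS)
    show "0 \<le> \<sigma> 0" using nxt[of 0] by (simp add: S0)
    show "\<sigma> n + \<delta> \<le> \<sigma> (Suc n)" for n using nxt[of "\<sigma> n + \<delta>"] by (simp add: SS)
    show "T \<inter> {0..<\<sigma> n} \<subseteq> (\<Union>i<n. {\<sigma> i..<\<sigma> i + \<delta>})" for n
    proof (induction n)
      case 0
      show ?case using nxt_le by (force simp: S0)
    next
      case (Suc n)
      show ?case
      proof
        fix t assume t: "t \<in> T \<inter> {0..<\<sigma> (Suc n)}"
        have "t < \<sigma> n + \<delta>" using nxt_le[of t "\<sigma> n + \<delta>"] t by (force simp: SS)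
        then show "t \<in> (\<Union>i<Suc n. {\<sigma> i..<\<sigma> i + \<delta>})"
          using Suc.IH t by (cases "t < \<sigma> n") (force simp: lessThan_Suc)+
      qed
    qed
  qed
qed

text \<open>The greedy covering bounds the measure of \<open>T\<close> up to
  \<open>\<sigma> n\<close> by \<open>n * \<delta>\<close>, while the density bounds it below by
  nearly \<open>\<beta> * \<sigma> n\<close>. The numerator is \<open>Suc n\<close> because
  \<open>\<sigma>\<close> is indexed from 0.\<close>

lemma separated_sequence_of_density:
  fixes T :: "real set"
  assumes T: "closed T" and beta: "0 < \<beta>" and delta: "0 < \<delta>"
    and dens: "\<And>e. 0 < e \<Longrightarrow> \<exists>R0>0. \<forall>R\<ge>R0. (\<beta> - e) * R \<le> measure lborel (T \<inter> {0..R})"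
  obtains \<sigma> :: "nat \<Rightarrow> real" where "\<And>n. \<sigma> n \<in> T" "0 \<le> \<sigma> 0" "\<And>n. \<sigma> n + \<delta> \<le> \<sigma> (Suc n)"
    "\<And>r. r < \<beta> / \<delta> \<Longrightarrow> \<forall>\<^sub>F n in sequentially. r < real (Suc n) / \<sigma> n"
proof -
  have unb: "\<exists>t\<in>T. x \<le> t" for x
  proof (rule ccontr)
    assume "\<not> (\<exists>t\<in>T. x \<le> t)"
    then have sub: "T \<inter> {0..R} \<subseteq> {0..\<bar>x\<bar>}" for R by fastforce
    obtain R0 where R0: "0 < R0" "\<And>R. R0 \<le> R \<Longrightarrow> (\<beta> - \<beta> / 2) * R \<le> measure lborel (T \<inter> {0..R})"
      using dens[of "\<beta> / 2"] beta by auto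
    \<comment> \<open>Large enough that the density would force measure at least
      \<open>\<bar>x\<bar> + 1\<close> into an interval of length
      \<open>\<bar>x\<bar>\<close>.\<close>
    define R where "R = max R0 (2 * (\<bar>x\<bar> + 1) / \<beta>)"
    have "measure lborel (T \<inter> {0..R}) \<le> measure lborel {0..\<bar>x\<bar>}"
      using sub T by (intro measure_mono_fmeasurable) (auto simp: fmeasurable_def)
    moreover have "(\<beta> / 2) * (2 * (\<bar>x\<bar> + 1) / \<beta>) \<le> (\<beta> / 2) * R"
      using beta by (intro mult_left_mono) (auto simp: R_def)
    ultimately show False using R0(2)[of R] beta by (simp add: R_def)
  qed
  obtain \<sigma> where s: "\<And>n. \<sigma> n \<in> T" "0 \<le> \<sigma> 0" "\<And>n. \<sigma> n + \<delta> \<le> \<sigma> (Suc n)"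
    and cov: "\<And>n. T \<inter> {0..<\<sigma> n} \<subseteq> (\<Union>i<n. {\<sigma> i..<\<sigma> i + \<delta>})"
    using greedy_separated_sequence[OF T unb delta] by blast
  have grow: "real n * \<delta> \<le> \<sigma> n" for n
  proof (induction n)
    case (Suc n) then show ?case using s(3)[of n] by (simp add: algebra_simps)
  qed (use s in simp)
  have count: "measure lborel (T \<inter> {0..\<sigma> n}) \<le> real n * \<delta>" for n
  proof -
    have "T \<inter> {0..\<sigma> n} \<subseteq> (\<Union>i<n. {\<sigma> i..<\<sigma> i + \<delta>}) \<union> {\<sigma> n}"
      using cov[of n] by (force simp: less_le)
    then have "emeasure lborel (T \<inter> {0..\<sigma> n}) \<le> emeasure lborel ((\<Union>i<n. {\<sigma> i..<\<sigma> i + \<delta>}) \<union> {\<sigma> n})"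
      by (rule emeasure_mono) auto
    also have "\<dots> \<le> emeasure lborel (\<Union>i<n. {\<sigma> i..<\<sigma> i + \<delta>}) + emeasure lborel {\<sigma> n}"
      by (rule emeasure_subadditive) auto
    also have "\<dots> \<le> (\<Sum>i<n. emeasure lborel {\<sigma> i..<\<sigma> i + \<delta>}) + emeasure lborel {\<sigma> n}"
      by (intro add_right_mono emeasure_subadditive_finite) auto
    also have "\<dots> = ennreal (real n * \<delta>)"
      using delta by (simp add: ennreal_mult ennreal_of_nat_eq_real_of_nat)
    finally show ?thesis
      using delta unfolding measure_def by (intro enn2real_leI) auto
  qed
  show thesis
  proof (rule that[OF s])
    fix r assume r: "r < \<beta> / \<delta>"
    \<comment> \<open>Chosen so that \<open>\<beta> - e\<close> is exactly
      \<open>r * \<delta>\<close>.\<close>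
    define e where "e = \<beta> - r * \<delta>"
    have e: "0 < e" using r delta by (simp add: e_def field_simps)
    then obtain R0 where R0: "0 < R0" "\<And>R. R0 \<le> R \<Longrightarrow> (\<beta> - e) * R \<le> measure lborel (T \<inter> {0..R})"
      using dens by blast
    have "\<forall>\<^sub>F n in sequentially. R0 / \<delta> \<le> real n"
      using filterlim_real_sequentially by (simp add: filterlim_at_top)
    then show "\<forall>\<^sub>F n in sequentially. r < real (Suc n) / \<sigma> n"
    proof eventually_elim
      case (elim n)
      then have R: "R0 \<le> \<sigma> n" using grow[of n] delta by (simp add: field_simps)
      then have "r * \<delta> * \<sigma> n \<le> real n * \<delta>"
        using R0(2)[OF R] count[of n] by (simp add: e_def)
      then have "r * \<sigma> n \<le> real n" using delta by (simp add: mult.commute mult.left_commute)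
      then show ?case using R R0(1) by (simp add: field_simps)
    qed
  qed
qed

section \<open>Coordinates in the basis and signed sums\<close>

lemma surj_linear_combination_of_span:
  fixes v :: "'n::finite \<Rightarrow> real ^ 'n"
  assumes "inj v" "span (range v) = UNIV"
  shows "surj (\<lambda>c :: real ^ 'n. \<Sum>k\<in>UNIV. c $ k *\<^sub>R v k)"
  unfolding surj_def
proof
  fix y
  have "y \<in> span (range v)" using assms(2) by simp
  then obtain u where "y = (\<Sum>w\<in>range v. u w *\<^sub>R w)"
    by (auto simp: span_finite)
  also have "\<dots> = (\<Sum>k\<in>UNIV. u (v k) *\<^sub>R v k)"
    by (simp add: sum.reindex[OF assms(1)])
  finally show "\<exists>c. y = (\<Sum>k\<in>UNIV. c $ k *\<^sub>R v k)"
    by (intro exI[of _ "\<chi> k. u (v k)"]) simp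
qed

text \<open>Taking the sign of each \<open>v k $ i\<close> as coefficient turns coordinate
  \<open>i\<close> of the signed sum into the sum of absolute values. This later puts all
  combinations with coefficients in [0, 1] into \<open>D\<close>.\<close>

lemma sum_abs_le_of_signed_sums:
  fixes v :: "'n::finite \<Rightarrow> real ^ 'm"
  assumes "\<And>s :: 'n \<Rightarrow> real. (\<And>k. s k \<in> {-1, 1}) \<Longrightarrow> (\<Sum>k\<in>UNIV. s k *\<^sub>R v k) \<in> cbox (- d) d"
  shows "(\<Sum>k\<in>UNIV. \<bar>v k $ i\<bar>) \<le> d $ i"
proof -
  define s where "s k = (if 0 \<le> v k $ i then 1 else - 1 :: real)" for k
  have "(\<Sum>k\<in>UNIV. s k *\<^sub>R v k) \<in> cbox (- d) d"
    by (rule assms) (simp add: s_def)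
  then have "(\<Sum>k\<in>UNIV. s k *\<^sub>R v k) $ i \<le> d $ i"
    by (simp add: mem_box_cart)
  also have "(\<Sum>k\<in>UNIV. s k *\<^sub>R v k) $ i = (\<Sum>k\<in>UNIV. \<bar>v k $ i\<bar>)"
    by (auto simp: s_def intro!: sum.cong)
  finally show ?thesis .
qed

text \<open>Non-emptiness of \<open>A'\<close> rules out cases such as empty \<open>A\<close>, where
  no visit time exists. A non-empty null set \<open>A'\<close> is covered: infinitely many visits
  are then still asserted.\<close>

theorem theorem4:
  fixes \<eta> \<theta> d :: "real ^ 'n"
    and A A' D :: "(real ^ 'n) set"
    and v :: "'n \<Rightarrow> real ^ 'n"
  assumes "compact A"
    and "A \<subseteq> cbox (\<chi> i. - (1/2)) (\<chi> i. 1/2)"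
    and "inj v" and "independent (range v)" and "span (range v) = UNIV"
    and "\<exists>t :: 'n \<Rightarrow> real. \<forall>k. v k \<in> {t k *\<^sub>R \<theta> + z | z. z \<in> int_lattice}"
    and "\<And>i. 0 < d $ i"
    and "D = cbox (- d) d"
    and "\<And>s :: 'n \<Rightarrow> real. (\<And>k. s k \<in> {-1, 1}) \<Longrightarrow> (\<Sum>k\<in>UNIV. s k *\<^sub>R v k) \<in> D"
    and "A' = {a \<in> A. {a + (3/2) *\<^sub>R x | x. x \<in> D} \<subseteq> A}"
    and "A' \<noteq> {}"
  shows "\<forall>\<delta>>0. \<exists>\<tau> :: nat \<Rightarrow> real.
           strict_mono_on {1..} \<tau> \<and>
           (\<forall>l\<ge>1. 0 \<le> \<tau> l) \<and>
           (\<forall>l\<ge>1. \<tau> l *\<^sub>R \<theta> \<in> {\<eta> + a + z | a z. a \<in> A \<and> z \<in> int_lattice}) \<and>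
           (\<forall>l\<ge>1. \<tau> (l + 1) \<ge> \<tau> l + \<delta>) \<and>
           liminf (\<lambda>l. ereal (real l / \<tau> l)) \<ge> ereal (1 / \<delta> * measure lebesgue A')"
proof (intro allI impI)
  fix \<delta> :: real assume delta: "0 < \<delta>"
  note memD = assms(8)
  have inD: "x \<in> D \<longleftrightarrow> (\<forall>i. \<bar>x $ i\<bar> \<le> d $ i)" for x
    by (auto simp: memD mem_box_cart abs_le_iff minus_le_iff)
  obtain t where "\<forall>k. v k \<in> {t k *\<^sub>R \<theta> + z | z. z \<in> int_lattice}"
    using assms(6) by blast
  then have lat: "v k - t k *\<^sub>R \<theta> \<in> int_lattice" for k
    by (auto dest!: spec[of _ k])
  \<comment> \<open>\<open>B\<close> contains \<open>A' + D/2\<close>, so it has positive volume even when \<open>A'\<close> is a null set.\<close>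
  define B where "B = {b. \<forall>x\<in>D. b + x \<in> A}"
  have zD: "0 \<in> D" using assms(7) by (simp add: inD less_imp_le)
  have B: "compact B"
  proof -
    have "B = (\<Inter>x\<in>D. (\<lambda>b. b + x) -` A)" by (auto simp: B_def)
    moreover have "closed ((\<lambda>b. b + x) -` A)" for x
      by (intro closed_vimage compact_imp_closed assms(1) continuous_intros)
    ultimately have "closed B" by (simp add: closed_INT)
    moreover have "B \<subseteq> A" using zD by (force simp: B_def)
    ultimately show ?thesis
      using assms(1) by (meson bounded_subset compact_eq_bounded_closed)
  qed
  \<comment> \<open>Since \<open>b + d\<close> and \<open>b - d\<close> both lie in the unit cube
    containing \<open>A\<close>, positivity of \<open>d\<close> makes the bound strict. Distinct
    points of \<open>B\<close> are therefore incongruent modulo the lattice.\<close>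
  have Bbd: "\<bar>b $ i\<bar> < 1/2" if "b \<in> B" for b i
  proof -
    have "d \<in> D" "- d \<in> D" using assms(7) by (auto simp: inD less_imp_le)
    then have "b + d \<in> A" "b - d \<in> A" using that by (force simp: B_def)+
    then have "b $ i + d $ i \<le> 1/2" "- (1/2) \<le> b $ i - d $ i"
      using assms(2) by (auto simp: subset_iff mem_box_cart)
    then show ?thesis using assms(7)[of i] by linarith
  qed
  have disj: "b = b'" if "b \<in> B" "b' \<in> B" "b - b' \<in> int_lattice" for b b'
  proof -
    have "b - b' = 0"
    proof (rule int_lattice_eq_if_close)
      show "\<bar>(b - b') $ i - 0 $ i\<bar> < 1" for i
        using Bbd[OF that(1), of i] Bbd[OF that(2), of i] by simp
    qed (use that in auto)
    then show ?thesis by simp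
  qed
  have BA: "b - (\<Sum>k\<in>UNIV. s k *\<^sub>R v k) \<in> A"
    if "b \<in> B" "\<And>k. 0 \<le> s k \<and> s k \<le> 1" for b s
  proof -
    have "\<bar>(\<Sum>k\<in>UNIV. s k *\<^sub>R v k) $ i\<bar> \<le> d $ i" for i
    proof -
      have "\<bar>(\<Sum>k\<in>UNIV. s k *\<^sub>R v k) $ i\<bar> \<le> (\<Sum>k\<in>UNIV. \<bar>s k * v k $ i\<bar>)"
        by (simp add: sum_abs)
      also have "\<dots> \<le> (\<Sum>k\<in>UNIV. \<bar>v k $ i\<bar>)"
        using that(2) by (intro sum_mono) (simp add: abs_mult mult_left_le_one_le)
      also have "\<dots> \<le> d $ i"
        using assms(9) by (intro sum_abs_le_of_signed_sums) (simp add: memD)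
      finally show ?thesis .
    qed
    then have "- (\<Sum>k\<in>UNIV. s k *\<^sub>R v k) \<in> D" by (simp add: inD)
    with that(1) show ?thesis by (force simp: B_def)
  qed
  have BI: "y \<in> B" if "a \<in> A'" "\<And>i. \<bar>y $ i - a $ i\<bar> \<le> d $ i / 2" for a y
    unfolding B_def
  proof (intro CollectI ballI)
    fix x assume x: "x \<in> D"
    \<comment> \<open>The origin of 3/2: half of \<open>D\<close> for moving from \<open>a\<close>
      to \<open>y\<close>, and a full \<open>D\<close> for the rounding error
      \<open>x\<close>.\<close>
    have "(2/3) *\<^sub>R (y - a + x) \<in> D"
      unfolding inD
    proof
      fix i
      have "\<bar>((2/3) *\<^sub>R (y - a + x)) $ i\<bar> = 2/3 * \<bar>y $ i - a $ i + x $ i\<bar>"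
        by (simp only: vector_scaleR_component vector_add_component vector_minus_component
            real_scaleR_def abs_mult abs_divide abs_numeral)
      also have "\<dots> \<le> 2/3 * (d $ i / 2 + d $ i)"
        using that(2) x
        by (intro mult_left_mono abs_triangle_ineq[THEN order_trans] add_mono) (auto simp: inD)
      finally show "\<bar>((2/3) *\<^sub>R (y - a + x)) $ i\<bar> \<le> d $ i"
        by simp
    qed
    then have "a + (3/2) *\<^sub>R ((2/3) *\<^sub>R (y - a + x)) \<in> A"
      using that(1) unfolding assms(10) by blast
    then show "y + x \<in> A" by simp
  qed
  define \<beta> where "\<beta> = measure lborel B"
  have beta: "0 < \<beta>"
  proof -
    obtain a where a: "a \<in> A'" using assms(11) by blast
    let ?c = "cbox (a - (1/2) *\<^sub>R d) (a + (1/2) *\<^sub>R d)"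
    have "?c \<subseteq> B"
    proof
      fix y assume "y \<in> ?c"
      then have "a $ i - d $ i / 2 \<le> y $ i" "y $ i \<le> a $ i + d $ i / 2" for i
        by (simp_all add: mem_box_cart)
      then have "\<bar>y $ i - a $ i\<bar> \<le> d $ i / 2" for i
        unfolding abs_le_iff by (smt (verit))
      then show "y \<in> B" by (rule BI[OF a])
    qed
    then have "measure lborel ?c \<le> \<beta>"
      unfolding \<beta>_def using B
      by (intro measure_mono_fmeasurable) (auto simp: fmeasurable_compact)
    moreover have "0 < measure lborel ?c"
    proof -
      have "?c \<noteq> {}" using assms(7) by (auto simp: interval_ne_empty_cart less_imp_le)
      then show ?thesis using assms(7) by (auto simp: content_cbox_cart intro!: prod_pos)
    qed
    ultimately show ?thesis by linarith
  qed
  have volA': "measure lebesgue A' \<le> \<beta>"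
  \<comment> \<open>Outside the sigma-algebra \<open>measure\<close> takes the default value 0, and
    the bound follows from \<open>beta\<close>.\<close>
  proof (cases "A' \<in> sets lebesgue")
    case True
    have "A' \<subseteq> B" using BI assms(7) by (fastforce simp: less_imp_le)
    then have "measure lebesgue A' \<le> measure lebesgue B"
      using B True by (intro measure_mono_fmeasurable) (auto simp: lmeasurable_compact)
    then show ?thesis using B by (simp add: \<beta>_def borel_compact)
  qed (use beta in \<open>simp add: measure_notin_sets\<close>)
  define T where "T = {\<tau>. \<tau> *\<^sub>R \<theta> - \<eta> \<in> {a + z | a z. a \<in> A \<and> z \<in> int_lattice}}"
  have T: "closed T"
    unfolding T_def using assms(1) by (rule closed_visit_times)
  obtain K where K: "0 \<le> K" "\<And>M. 0 \<le> M \<Longrightarrow> \<exists>C\<ge>0. \<forall>R\<ge>0.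
      \<beta> * (2 * M) ^ CARD('n) * R
      \<le> (measure lborel (T \<inter> {0..R}) + C) * (2 * (M + K)) ^ CARD('n)"
    unfolding \<beta>_def T_def
    using visit_times_count[OF assms(1) B disj lat surj_linear_combination_of_span[OF assms(3,5)] BA,
        of \<eta>] by blast
  have "\<exists>R0>0. \<forall>R\<ge>R0. (\<beta> - e) * R \<le> measure lborel (T \<inter> {0..R})" if e: "0 < e" for e
  proof -
    obtain R0 where "0 < R0" "\<And>R. R0 \<le> R \<Longrightarrow> (\<beta> - e) * R \<le> measure lborel (T \<inter> {0..R})"
      using lower_density_of_box_counts[where m = "\<lambda>R. measure lborel (T \<inter> {0..R})", OF K e]
      by blast
    then show ?thesis by blast
  qed
  then obtain \<sigma> where s: "\<And>n. \<sigma> n \<in> T" "0 \<le> \<sigma> 0" "\<And>n. \<sigma> n + \<delta> \<le> \<sigma> (Suc n)"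
    and lim: "\<And>r. r < \<beta> / \<delta> \<Longrightarrow> \<forall>\<^sub>F n in sequentially. r < real (Suc n) / \<sigma> n"
    by (rule separated_sequence_of_density[OF T beta delta]) blast+
  have "strict_mono \<sigma>"
    unfolding strict_mono_Suc_iff using s(3) delta by (smt (verit))
  \<comment> \<open>Reindexed to start at 1. Truncated subtraction gives
    \<open>\<tau> 0 = \<tau> 1\<close>, so strict monotonicity holds only from 1 on; the liminf
    ignores index 0.\<close>
  define \<tau> where "\<tau> l = \<sigma> (l - 1)" for l
  have "strict_mono_on {1..} \<tau>"
    using \<open>strict_mono \<sigma>\<close> by (intro strict_mono_onI) (auto simp: \<tau>_def strict_mono_less)
  moreover have "0 \<le> \<tau> l" for l
    using s(2) \<open>strict_mono \<sigma>\<close> strict_mono_less_eq[of \<sigma> 0 "l - 1"] by (simp add: \<tau>_def)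
  moreover have "\<tau> l *\<^sub>R \<theta> \<in> {\<eta> + a + z | a z. a \<in> A \<and> z \<in> int_lattice}" for l
  proof -
    obtain a z where "\<tau> l *\<^sub>R \<theta> - \<eta> = a + z" "a \<in> A" "z \<in> int_lattice"
      using s(1)[of "l - 1"] by (auto simp: T_def \<tau>_def)
    then show ?thesis by (force simp: algebra_simps)
  qed
  moreover have "\<tau> l + \<delta> \<le> \<tau> (l + 1)" if "1 \<le> l" for l
    using s(3)[of "l - 1"] that by (simp add: \<tau>_def)
  moreover have "ereal (1 / \<delta> * measure lebesgue A') \<le> liminf (\<lambda>l. ereal (real l / \<tau> l))"
    unfolding le_Liminf_iff
  proof (intro allI impI)
    fix y assume y: "y < ereal (1 / \<delta> * measure lebesgue A')"
    show "\<forall>\<^sub>F l in sequentially. y < ereal (real l / \<tau> l)"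
    proof (cases y)
      case (real r)
      have "1 / \<delta> * measure lebesgue A' \<le> \<beta> / \<delta>"
        using volA' delta by (simp add: divide_right_mono)
      then have "r < \<beta> / \<delta>" using y real by simp
      from lim[OF this] have "\<forall>\<^sub>F n in sequentially. y < ereal (real (Suc n) / \<tau> (Suc n))"
        by (simp add: \<tau>_def real)
      then show ?thesis by (rule eventually_sequentially_Suc[THEN iffD1])
    qed (use y in auto)
  qed
  ultimately show "\<exists>\<tau> :: nat \<Rightarrow> real.
           strict_mono_on {1..} \<tau> \<and>
           (\<forall>l\<ge>1. 0 \<le> \<tau> l) \<and>
           (\<forall>l\<ge>1. \<tau> l *\<^sub>R \<theta> \<in> {\<eta> + a + z | a z. a \<in> A \<and> z \<in> int_lattice}) \<and>
           (\<forall>l\<ge>1. \<tau> (l + 1) \<ge> \<tau> l + \<delta>) \<and>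
           liminf (\<lambda>l. ereal (real l / \<tau> l)) \<ge> ereal (1 / \<delta> * measure lebesgue A')"
    by blast
qed

end
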